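(* Let $C\subseteq\mathbb{R}^2$ be the interior of a convex body. Let $A\subseteq\mathbb{R}^2$ be a compact set such that $2C\subseteq A$. Let $X$ be a set of $n$ i.i.d. uniformly random points in $A$. Let $$a'_k(X):=\bigl|\{X\cap(x+C) : x\in\mathbb{R}^2,\ x+C\subseteq A,\ |X\cap(x+C)|=k,\ X\cap\operatorname{bd}(x+C)=\emptyset\}\bigr|,$$ and let $a_k(X)$ be the number of $T_C$-$k$-sets of $X$. Let $p=\operatorname{area}(C)/\operatorname{area}(A)$. Then there exists a (deterministic, integer-valued) function $k(n)$ such that $$\mathbb{E}\bigl(a_{k(n)}(X)\bigr)\ge\mathbb{E}\bigl(a'_{k(n)}(X)\bigr)\ge\Omega\left(\frac{n^{3/2}}{(\log n)^{5/2}}\right)$$ and $|k(n)-pn|\le O(\sqrt{n\log n})$, where the function $k(n)$ and the constants in $O,\Omega$ depend only on $A$ and $C$.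
   Context: A convex body is a compact convex set with non-empty interior. $T_C=\{x+C:x\in\mathbb{R}^2\}$ is the family of translations of $C$. A $T_C$-$k$-set of a finite set $S\subseteq\mathbb{R}^2$ is a subset $T\subseteq S$ of $k$ points such that for some $Q\in T_C$ we have $S\cap\operatorname{bd}Q=\emptyset$ and $T=S\cap Q$. $2C=\{2y:y\in C\}$. Asymptotics are as $n\to\infty$. *)

theory Defs
  imports "HOL-Probability.Probability" "HOL-Library.Landau_Symbols"
begin

definition convex_body :: "(real^2) set \<Rightarrow> bool" where
  "convex_body K \<longleftrightarrow> compact K \<and> convex K \<and> interior K \<noteq> {}"

abbreviation area :: "(real^2) set \<Rightarrow> real" where
  "area S \<equiv> measure lborel S"

definition translates :: "(real^2) set \<Rightarrow> (real^2) set set" where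
  "translates C = {(+) x ` C | x. True}"

text \<open>\<open>k_sets (translates C) k S\<close> is the set of all \<open>T\<^sub>C\<close>-\<open>k\<close>-sets of the finite set \<open>S\<close>.\<close>

definition k_sets :: "(real^2) set set \<Rightarrow> nat \<Rightarrow> (real^2) set \<Rightarrow> (real^2) set set" where
  "k_sets \<Q> k S = {T. T \<subseteq> S \<and> card T = k \<and> (\<exists>Q\<in>\<Q>. S \<inter> frontier Q = {} \<and> T = S \<inter> Q)}"

definition num_k_sets :: "(real^2) set \<Rightarrow> nat \<Rightarrow> (real^2) set \<Rightarrow> nat" where
  "num_k_sets C k X = card (k_sets (translates C) k X)"

definition num_k_sets_within ::
    "(real^2) set \<Rightarrow> (real^2) set \<Rightarrow> nat \<Rightarrow> (real^2) set \<Rightarrow> nat" where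
  "num_k_sets_within A C k X =
     card {X \<inter> (+) x ` C | x.
             (+) x ` C \<subseteq> A \<and> card (X \<inter> (+) x ` C) = k \<and> X \<inter> frontier ((+) x ` C) = {}}"

text \<open>
  The law of \<open>n\<close> independent uniformly distributed points \<open>\<omega> 0, \<dots>, \<omega> (n - 1)\<close> of \<open>A\<close>.
  The associated random point set is \<open>\<omega> ` {..<n}\<close>, which has \<open>n\<close> elements almost surely if
  \<open>A\<close> has finite positive area.
\<close>

definition iid_uniform :: "(real^2) set \<Rightarrow> nat \<Rightarrow> (nat \<Rightarrow> real^2) measure" where
  "iid_uniform A n = (\<Pi>\<^sub>M i\<in>{..<n}. uniform_measure lborel A)"

definition expected :: "(real^2) set \<Rightarrow> nat \<Rightarrow> ((real^2) set \<Rightarrow> nat) \<Rightarrow> real" where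
  "expected A n f = (\<integral>\<omega>. real (f (\<omega> ` {..<n})) \<partial>iid_uniform A n)"

end

theory Submission
  imports Defs "HOL-Real_Asymp.Real_Asymp"
begin

text \<open>
  By convexity \<open>x + C \<subseteq> 2C \<subseteq> A\<close> for every \<open>x \<in> C\<close>, so a two-dimensional family of translates is
  available inside \<open>A\<close>. Place an \<open>M \<times> M\<close> grid of translation vectors in a small ball inside \<open>C\<close>,
  with \<open>M\<close> of order \<open>n / ln n\<close>. The argument is that, with probability at least \<open>1/2\<close>, these
  translates cut out \<open>M\<^sup>2\<close> pairwise different subsets of the random points, all of size within
  \<open>\<epsilon> = sqrt (n ln n)\<close> of \<open>p n\<close>. As there are only \<open>O(\<epsilon>)\<close> possible sizes, some size \<open>k(n)\<close> has
  expectation at least of order \<open>(n / ln n)\<^sup>2 / sqrt (n ln n) = n\<^bsup>3/2\<^esup> / (ln n)\<^bsup>5/2\<^esup>\<close>.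

  The three properties of the random cuts come from the following sources.

  \<^item> Different subsets: two grid vectors are at distance at least of order \<open>1/M\<close>, so the
    difference of their translates has area at least of order \<open>1/M\<close>
    (\<open>area_translate_difference_lower_bound\<close>) and is missed by all \<open>n\<close> points with probability at
    most \<open>exp (- c n / M)\<close>. With \<open>M\<close> a small multiple of \<open>n / ln n\<close> this is at most \<open>n\<^bsup>-5\<^esup>\<close>, which
    beats the number \<open>M\<^sup>4\<close> of pairs.
  \<^item> Sizes: each translate contains every point with probability \<open>p\<close>, so Hoeffding's inequality
    bounds the probability of a deviation \<open>\<epsilon>\<close> by \<open>2 n\<^bsup>-2\<^esup>\<close>, against \<open>M\<^sup>2 \<le> (n / ln n)\<^sup>2\<close> translates.
  \<^item> Clean boundaries: the boundary of a convex set is a null set.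

  The union bound over these events is \<open>sum_expected_ge\<close>, the pigeonhole step is
  \<open>exists_k_expected_ge\<close>, and the choice of \<open>M\<close> is made in \<open>grid_size_asymptotics\<close>. As
  the expectations are Bochner integrals, the counting functions must also be shown measurable
  although they quantify over uncountably many translates (\<open>num_k_sets_within_measurable\<close>).
\<close>

section \<open>Independent points with a common law\<close>

lemma indep_vars_PiM_coordinates:
  assumes "prob_space U"
  shows "prob_space.indep_vars (PiM I (\<lambda>_. U)) (\<lambda>_. U) (\<lambda>i \<omega>. \<omega> i) I"
proof (cases "I = {}")
  case True
  interpret P: prob_space "PiM I (\<lambda>_. U)" using assms by (intro prob_space_PiM)
  show ?thesis using True unfolding P.indep_vars_def P.indep_sets_def by auto
next
  case False
  interpret P: prob_space "PiM I (\<lambda>_. U)" using assms by (intro prob_space_PiM)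
  have "distr (PiM I (\<lambda>_. U)) (PiM I (\<lambda>_. U)) (\<lambda>\<omega>. \<lambda>i\<in>I. \<omega> i) = PiM I (\<lambda>_. U)"
    by (subst distr_cong[OF refl refl, of _ _ "\<lambda>\<omega>. \<omega>"]) (auto simp: space_PiM PiE_def extensional_restrict distr_id)
  also have "\<dots> = (\<Pi>\<^sub>M i\<in>I. distr (PiM I (\<lambda>_. U)) U (\<lambda>\<omega>. \<omega> i))"
    by (intro PiM_cong refl distr_PiM_component[symmetric] assms)
  finally show ?thesis
    by (subst P.indep_vars_iff_distr_eq_PiM') (use False in auto)
qed

lemma prob_all_points_avoid:
  assumes "prob_space U" and B: "B \<in> sets U"
  shows "measure (PiM {..<n::nat} (\<lambda>_. U)) {\<omega> \<in> space (PiM {..<n} (\<lambda>_. U)). \<forall>i<n. \<omega> i \<notin> B}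
    = (1 - measure U B) ^ n"
proof -
  interpret U: prob_space U by fact
  interpret P: product_sigma_finite "\<lambda>_::nat. U"
    by (rule product_sigma_finite.intro) (rule U.sigma_finite_measure_axioms)
  have "{\<omega> \<in> space (PiM {..<n} (\<lambda>_. U)). \<forall>i<n. \<omega> i \<notin> B} = Pi\<^sub>E {..<n} (\<lambda>_. space U - B)"
    unfolding space_PiM PiE_iff set_eq_iff mem_Collect_eq Diff_iff by blast
  moreover have "emeasure (PiM {..<n} (\<lambda>_. U)) (Pi\<^sub>E {..<n} (\<lambda>_. space U - B)) = (\<Prod>i<n. emeasure U (space U - B))"
    by (rule P.emeasure_PiM) (use B in auto)
  ultimately have "emeasure (PiM {..<n} (\<lambda>_. U)) {\<omega> \<in> space (PiM {..<n} (\<lambda>_. U)). \<forall>i<n. \<omega> i \<notin> B}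
      = ennreal ((1 - measure U B) ^ n)"
    using B by (simp add: U.emeasure_eq_measure U.prob_compl ennreal_power)
  then show ?thesis
    by (rule measure_eq_emeasure_eq_ennreal[rotated]) simp
qed

text \<open>Hoeffding's inequality for the indicators of the events \<open>\<omega> i \<in> B\<close>.\<close>
lemma prob_count_deviation:
  assumes "prob_space U" and B: "B \<in> sets U" and "0 \<le> \<epsilon>" and "0 < n"
  shows "measure (PiM {..<n} (\<lambda>_. U)) {\<omega> \<in> space (PiM {..<n} (\<lambda>_. U)).
      \<epsilon> \<le> \<bar>real (card {i. i < n \<and> \<omega> i \<in> B}) - measure U B * real n\<bar>} \<le> 2 * exp (- 2 * \<epsilon>\<^sup>2 / real n)"
proof -
  let ?M = "PiM {..<n} (\<lambda>_. U)"
  let ?X = "\<lambda>i \<omega>. indicator B (\<omega> i) :: real"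
  interpret P: prob_space ?M using assms by (intro prob_space_PiM)
  have ind: "P.indep_vars (\<lambda>_. borel) ?X {..<n}"
    by (rule P.indep_vars_compose2[OF indep_vars_PiM_coordinates[OF assms(1)]]) (use B in auto)
  have E: "P.expectation (?X i) = measure U B" if "i < n" for i
  proof -
    have "P.expectation (?X i) = (\<integral>x. indicator B x \<partial>distr ?M U (\<lambda>\<omega>. \<omega> i))"
      by (rule integral_distr[symmetric]) (use B that in auto)
    also have "distr ?M U (\<lambda>\<omega>. \<omega> i) = U"
      by (rule distr_PiM_component) (use assms that in auto)
    finally show ?thesis using B by simp
  qed
  interpret H: Hoeffding_ineq ?M "{..<n}" ?X "\<lambda>_. 0" "\<lambda>_. 1" "\<Sum>i<n. P.expectation (?X i)"
    by unfold_locales (use ind in \<open>auto simp: indicator_def\<close>)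
  have S: "(\<Sum>i<n. ?X i \<omega>) = real (card {i. i < n \<and> \<omega> i \<in> B})" for \<omega>
  proof -
    have "real (card {i. i < n \<and> \<omega> i \<in> B}) = (\<Sum>i\<in>{i\<in>{..<n}. \<omega> i \<in> B}. 1)" by simp
    also have "\<dots> = (\<Sum>i<n. if \<omega> i \<in> B then 1 else 0)" by (rule sum.inter_filter) simp
    also have "\<dots> = (\<Sum>i<n. ?X i \<omega>)" by (intro sum.cong) auto
    finally show ?thesis by (rule sym)
  qed
  show ?thesis
    using H.Hoeffding_ineq_abs_ge[OF \<open>0 \<le> \<epsilon>\<close>] \<open>0 < n\<close> by (simp add: S E mult.commute)
qed

text \<open>
  Coincidences must be excluded because a point set forgets multiplicities, whereas the
  concentration bound is about indices. Any two coordinates have the product law, and an atomless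
  law gives measure zero to each section of the diagonal.
\<close>
lemma AE_points_distinct:
  fixes U :: "'a::{second_countable_topology, t2_space} measure"
  assumes "prob_space U" and sets: "sets U = sets borel" and atomless: "\<And>x. emeasure U {x} = 0"
    and "finite I"
  shows "AE \<omega> in PiM I (\<lambda>_. U). inj_on \<omega> I"
proof -
  let ?M = "PiM I (\<lambda>_. U)"
  interpret P: prob_space ?M using assms by (intro prob_space_PiM)
  interpret U: prob_space U by fact
  interpret UU: pair_prob_space U U ..
  have "AE \<omega> in ?M. \<omega> i \<noteq> \<omega> j" if ij: "i \<in> I" "j \<in> I" "i \<noteq> j" for i j
  proof -
    have comp: "distr ?M U (\<lambda>\<omega>. \<omega> i) = U" if "i \<in> I" for i
      by (rule distr_PiM_component) (use assms that in auto)
    have "P.indep_var (PiM {i} (\<lambda>_. U)) (\<lambda>\<omega>. restrict (\<lambda>i. \<omega> i) {i}) (PiM {j} (\<lambda>_. U)) (\<lambda>\<omega>. restrict (\<lambda>i. \<omega> i) {j})"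
      by (rule P.indep_var_restrict[OF indep_vars_PiM_coordinates[OF assms(1)]]) (use ij in auto)
    from P.indep_var_compose[OF this, of "\<lambda>\<omega>. \<omega> i" U "\<lambda>\<omega>. \<omega> j" U]
    have "P.indep_var U (\<lambda>\<omega>. \<omega> i) U (\<lambda>\<omega>. \<omega> j)" by (simp add: comp_def)
    then have D: "U \<Otimes>\<^sub>M U = distr ?M (U \<Otimes>\<^sub>M U) (\<lambda>\<omega>. (\<omega> i, \<omega> j))"
      unfolding P.indep_var_distribution_eq using ij by (simp add: comp)
    have [measurable_cong]: "sets U = sets borel" by fact
    have m: "{x \<in> space (U \<Otimes>\<^sub>M U). fst x \<noteq> snd x} \<in> sets (U \<Otimes>\<^sub>M U)"
      by measurable
    have "AE y in U. x \<noteq> y" for x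
      by (rule AE_I[where N = "{x}"]) (auto simp: atomless sets)
    then have "AE x in U \<Otimes>\<^sub>M U. fst x \<noteq> snd x"
      by (intro UU.AE_pair_measure m) auto
    then have "AE x in distr ?M (U \<Otimes>\<^sub>M U) (\<lambda>\<omega>. (\<omega> i, \<omega> j)). fst x \<noteq> snd x"
      unfolding D[symmetric] .
    then show ?thesis
      by (subst (asm) AE_distr_iff) (use ij m in auto)
  qed
  then have "AE \<omega> in ?M. \<forall>i\<in>I. \<forall>j\<in>I. i \<noteq> j \<longrightarrow> \<omega> i \<noteq> \<omega> j"
    using \<open>finite I\<close> by (intro AE_finite_allI AE_impI) auto
  then show ?thesis by eventually_elim (auto simp: inj_on_def)
qed

section \<open>Translates of an open set\<close>

text \<open>
  With \<open>E = C - (v + C)\<close>, about \<open>d / |v|\<close> translates of \<open>E\<close> along \<open>v\<close> cover \<open>C\<close>: starting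
  at \<open>y \<in> C\<close> and walking in steps of \<open>- v\<close>, one leaves \<open>C\<close> before covering a distance larger
  than the diameter \<open>d\<close>, and the last position inside \<open>C\<close> lies in \<open>E\<close>. Hence the area of \<open>E\<close>
  is at least the proportion \<open>|v| / (2 d)\<close> of the area of \<open>C\<close>.
\<close>
lemma area_translate_difference_lower_bound:
  fixes C :: "'a::euclidean_space set"
  assumes "open C" "bounded C" and diam: "\<And>x y. x \<in> C \<Longrightarrow> y \<in> C \<Longrightarrow> dist x y \<le> d"
    and v: "v \<noteq> 0" "norm v \<le> d"
  shows "measure lborel C * norm v / (2 * d) \<le> measure lborel (C - (+) v ` C)"
proof -
  let ?E = "C - (+) v ` C"
  define m where "m = nat \<lfloor>d / norm v\<rfloor> + 1"
  have nv: "0 < norm v" "0 < d" using v zero_less_norm_iff[of v] by linarith+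
  have m: "d < real m * norm v" "real m \<le> 2 * d / norm v"
  proof -
    have "d / norm v < real m" using nv unfolding m_def by simp linarith
    then show "d < real m * norm v" using nv by (simp add: field_simps)
    have "1 \<le> d / norm v" using v nv by (simp add: field_simps)
    then have "real m \<le> d / norm v + d / norm v" unfolding m_def by simp linarith
    then show "real m \<le> 2 * d / norm v" by simp
  qed
  have C: "C \<in> lmeasurable" using assms by (intro lmeasurable_open)
  have E: "?E \<in> lmeasurable" using C by (intro fmeasurable.Diff measurable_translation)
  have cover: "C \<subseteq> (\<Union>j<m. (+) (real j *\<^sub>R v) ` ?E)"
  proof
    fix y assume y: "y \<in> C"
    \<comment> \<open>Position of \<open>y\<close> after \<open>j\<close> steps; the last step inside \<open>C\<close> is found by induction.\<close>
    define P where "P j \<longleftrightarrow> y - real j *\<^sub>R v \<in> C" for j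
    have "\<not> P m"
    proof
      assume "P m"
      then have "dist y (y - real m *\<^sub>R v) \<le> d" unfolding P_def by (rule diam[OF y])
      then show False using m(1) by (simp add: dist_norm)
    qed
    moreover have "P 0" using y by (simp add: P_def)
    ultimately obtain j where "j < m" "P j" "\<not> P (Suc j)"
      by (metis inc_induct lessI less_Suc_eq_le nat_induct_at_least not_less zero_le dec_induct)
    then have "y - real j *\<^sub>R v \<in> C" "y - real j *\<^sub>R v \<notin> (+) v ` C"
      by (auto simp: P_def algebra_simps)
    then have "y \<in> (+) (real j *\<^sub>R v) ` ?E" by (intro image_eqI[of _ _ "y - real j *\<^sub>R v"]) auto
    then show "y \<in> (\<Union>j<m. (+) (real j *\<^sub>R v) ` ?E)" using \<open>j < m\<close> by blast
  qed
  have "measure lebesgue C \<le> measure lebesgue (\<Union>j<m. (+) (real j *\<^sub>R v) ` ?E)"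
    using C E by (intro measure_mono_fmeasurable cover fmeasurable.finite_UN measurable_translation) (auto dest: fmeasurableD)
  also have "\<dots> \<le> (\<Sum>j<m. measure lebesgue ((+) (real j *\<^sub>R v) ` ?E))"
    using E by (intro measure_UNION_le) (auto intro: fmeasurableD measurable_translation)
  also have "\<dots> = real m * measure lebesgue ?E" by (simp add: measure_translation)
  also have "\<dots> \<le> 2 * d / norm v * measure lebesgue ?E" by (intro mult_right_mono m) auto
  finally have "measure lebesgue C * norm v / (2 * d) \<le> measure lebesgue ?E"
    using nv by (simp add: field_simps)
  moreover have "measure lebesgue C = measure lborel C" using assms by (intro measure_completion) simp
  moreover have "measure lebesgue ?E = measure lborel ?E"
    using assms by (intro measure_completion) (simp add: open_translation borel_open)
  ultimately show ?thesis by simp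
qed

lemma measure_lborel_translation:
  assumes "S \<in> sets borel"
  shows "measure lborel ((+) x ` S) = measure lborel (S :: 'a::euclidean_space set)"
proof -
  have "(+) x ` S = (\<lambda>y. y - x) -` S \<inter> space borel" by (auto simp: image_iff intro!: bexI[of _ "_ - x"])
  also have "\<dots> \<in> sets borel" using assms by (intro measurable_sets[of _ borel borel]) auto
  finally show ?thesis using measure_translation[of x S] assms by (simp add: measure_completion)
qed

lemma frontier_convex_null:
  fixes C :: "'a::euclidean_space set"
  assumes "convex C"
  shows "frontier C \<in> null_sets lborel"
  using negligible_convex_frontier[OF assms]
  by (auto simp: null_sets_completion_iff negligible_iff_null_sets)

section \<open>Measurability of the number of subsets cut out\<close>

lemma mem_translate_iff:
  fixes x y :: "'a::ab_group_add"
  shows "y \<in> (+) x ` C \<longleftrightarrow> y - x \<in> C"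
  by (auto simp: image_iff algebra_simps intro: bexI[of _ "y - x"])

lemma frontier_translate_open:
  fixes C :: "'a::real_normed_vector set"
  assumes "open C"
  shows "frontier ((+) x ` C) = {y. y - x \<in> closure C \<and> y - x \<notin> C}"
proof -
  have "open ((+) x ` C)" using assms by (rule open_translation)
  then show ?thesis
    by (auto simp: frontier_def interior_open closure_translation mem_translate_iff)
qed

text \<open>
  The translate \<open>x + C\<close> contains exactly the points with index in \<open>I\<close> and has no point on its
  boundary. For fixed \<open>\<omega>\<close> and \<open>I\<close> this is an open condition on \<open>x\<close>, since \<open>C\<close> and the complement
  of its closure are open.
\<close>
definition clean_trace :: "'a::real_normed_vector set \<Rightarrow> nat \<Rightarrow> (nat \<Rightarrow> 'a) \<Rightarrow> nat set \<Rightarrow> 'a \<Rightarrow> bool" where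
  "clean_trace C n \<omega> I x \<longleftrightarrow> (\<forall>i<n. if i \<in> I then \<omega> i - x \<in> C else \<omega> i - x \<in> - closure C)"

text \<open>
  The identity is exact even when points coincide: an index set that is cut out is a union of
  fibres of \<open>\<omega>\<close>, so it is determined by its image.
\<close>
lemma num_k_sets_within_eq_sum:
  assumes "open C"
  shows "num_k_sets_within A C k (\<omega> ` {..<n}) =
    (\<Sum>I\<in>Pow {..<n}. of_bool ((\<exists>x\<in>{x. (+) x ` C \<subseteq> A}. clean_trace C n \<omega> I x) \<and> card (\<omega> ` I) = k))"
proof -
  let ?X = "\<omega> ` {..<n}"
  let ?P = "\<lambda>I. (\<exists>x\<in>{x. (+) x ` C \<subseteq> A}. clean_trace C n \<omega> I x) \<and> card (\<omega> ` I) = k"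
  have mem: "\<omega> i \<in> (+) x ` C \<longleftrightarrow> i \<in> I" and nfr: "\<omega> i \<notin> frontier ((+) x ` C)"
    if "clean_trace C n \<omega> I x" "i < n" for x I i
  proof -
    have *: "if i \<in> I then \<omega> i - x \<in> C else \<omega> i - x \<in> - closure C"
      using that unfolding clean_trace_def by blast
    show "\<omega> i \<in> (+) x ` C \<longleftrightarrow> i \<in> I"
      using * closure_subset[of C] by (auto simp: mem_translate_iff split: if_splits)
    show "\<omega> i \<notin> frontier ((+) x ` C)"
      using * by (auto simp: frontier_translate_open[OF assms] split: if_splits)
  qed
  have tr: "?X \<inter> (+) x ` C = \<omega> ` I" if "clean_trace C n \<omega> I x" "I \<subseteq> {..<n}" for x I
    using mem[OF that(1)] that(2) by blast
  have fr: "?X \<inter> frontier ((+) x ` C) = {}" if "clean_trace C n \<omega> I x" for x I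
    using nfr[OF that] by blast
  have cl: "clean_trace C n \<omega> {i. i < n \<and> \<omega> i - x \<in> C} x"
    if *: "?X \<inter> frontier ((+) x ` C) = {}" for x
    unfolding clean_trace_def
  proof (intro allI impI)
    fix i assume "i < n"
    then have "\<omega> i \<notin> frontier ((+) x ` C)" using * by blast
    with \<open>i < n\<close> show "if i \<in> {i. i < n \<and> \<omega> i - x \<in> C} then \<omega> i - x \<in> C else \<omega> i - x \<in> - closure C"
      by (auto simp: frontier_translate_open[OF assms])
  qed
  have inj: "inj_on ((`) \<omega>) {I \<in> Pow {..<n}. ?P I}"
  proof (rule inj_onI)
    fix I J assume I: "I \<in> {I \<in> Pow {..<n}. ?P I}" and J: "J \<in> {I \<in> Pow {..<n}. ?P I}" and eq: "\<omega> ` I = \<omega> ` J"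
    have sat: "i \<in> I \<longleftrightarrow> \<omega> i \<in> \<omega> ` I" if "i < n" "clean_trace C n \<omega> I x" "I \<subseteq> {..<n}" for i I x
      using mem[OF that(2,1)] tr[OF that(2,3)] that(1) by blast
    from I J obtain x y where *: "I \<subseteq> {..<n}" "clean_trace C n \<omega> I x" "J \<subseteq> {..<n}" "clean_trace C n \<omega> J y"
      by blast
    have "i \<in> I \<longleftrightarrow> i \<in> J" if "i < n" for i
      using sat[OF that *(2,1)] sat[OF that *(4,3)] eq by simp
    then show "I = J" using *(1,3) by blast
  qed
  have "{?X \<inter> (+) x ` C | x. (+) x ` C \<subseteq> A \<and> card (?X \<inter> (+) x ` C) = k \<and> ?X \<inter> frontier ((+) x ` C) = {}}
      = (`) \<omega> ` {I \<in> Pow {..<n}. ?P I}" (is "?L = ?R")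
  proof (intro equalityI subsetI)
    fix T assume "T \<in> ?L"
    then obtain x where x: "T = ?X \<inter> (+) x ` C" "(+) x ` C \<subseteq> A" "card T = k" "?X \<inter> frontier ((+) x ` C) = {}" by blast
    let ?I = "{i. i < n \<and> \<omega> i - x \<in> C}"
    have "T = \<omega> ` ?I" using tr[OF cl[OF x(4)]] x(1) by blast
    moreover have "?P ?I" using calculation x(2,3) cl[OF x(4)] by auto
    ultimately show "T \<in> ?R" by (intro image_eqI[of _ _ ?I]) auto
  next
    fix T assume "T \<in> ?R"
    then obtain I where I: "T = \<omega> ` I" "I \<in> {I \<in> Pow {..<n}. ?P I}" by (rule imageE)
    then obtain x where x: "I \<subseteq> {..<n}" "(+) x ` C \<subseteq> A" "clean_trace C n \<omega> I x" "card (\<omega> ` I) = k" by blast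
    have "T = ?X \<inter> (+) x ` C" using tr[OF x(3,1)] I(1) by simp
    moreover have "card (?X \<inter> (+) x ` C) = k" using tr[OF x(3,1)] x(4) by simp
    ultimately show "T \<in> ?L" using fr[OF x(3)] x(2) by blast
  qed
  then have "num_k_sets_within A C k ?X = card {I \<in> Pow {..<n}. ?P I}"
    unfolding num_k_sets_within_def by (simp only: card_image[OF inj])
  also have "\<dots> = (\<Sum>I\<in>{I \<in> Pow {..<n}. ?P I}. 1)" by simp
  also have "\<dots> = (\<Sum>I\<in>Pow {..<n}. if ?P I then 1 else 0)" by (rule sum.inter_filter) simp
  also have "\<dots> = (\<Sum>I\<in>Pow {..<n}. of_bool (?P I))" by (intro sum.cong) auto
  finally show ?thesis .
qed

text \<open>
  This turns the size of a set of random points into finitely many equations between the points.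
\<close>
lemma card_image_eq_iff_section:
  assumes "finite I"
  shows "card (f ` I) = k \<longleftrightarrow>
    (\<exists>J\<in>Pow I. card J = k \<and> (\<forall>i\<in>J. \<forall>j\<in>J. f i = f j \<longrightarrow> i = j) \<and> (\<forall>i\<in>I. \<exists>j\<in>J. f i = f j))" (is "?L \<longleftrightarrow> ?R")
proof
  assume ?L
  obtain J where J: "J \<subseteq> I" "inj_on f J" "f ` I = f ` J"
    using subset_image_inj[of "f ` I" f I] by auto
  have "\<exists>j\<in>J. f i = f j" if "i \<in> I" for i
    using imageI[OF that, of f] J(3) by auto
  then show ?R using J \<open>?L\<close> card_image[OF J(2)] by (intro bexI[of _ J]) (auto simp: inj_on_def)
next
  assume ?R
  then obtain J where J: "J \<subseteq> I" "card J = k" "inj_on f J" "\<forall>i\<in>I. \<exists>j\<in>J. f i = f j" by (auto simp: inj_on_def)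
  then have "f ` I = f ` J" by auto
  then show ?L using card_image[OF J(3)] J(2) by simp
qed

text \<open>
  Because \<open>clean_trace\<close> is open in \<open>x\<close>, the translation vectors may be restricted to a countable
  dense subset of the admissible ones. The density has to be relative to the admissible vectors:
  they may form a set with empty interior, which can miss a given countable dense set of the plane.
\<close>
lemma num_k_sets_within_measurable:
  assumes "open C" and sets: "sets (U :: (real^2) measure) = sets borel"
  shows "(\<lambda>\<omega>. real (num_k_sets_within A C k (\<omega> ` {..<n}))) \<in> borel_measurable (PiM {..<n::nat} (\<lambda>_. U))"
proof -
  let ?M = "PiM {..<n} (\<lambda>_. U)"
  define S where "S = {x. (+) x ` C \<subseteq> A}"
  obtain D where D: "countable D" "D \<subseteq> S" "S \<subseteq> closure D" using separable by blast
  have dense: "(\<exists>x\<in>S. clean_trace C n \<omega> I x) \<longleftrightarrow> (\<exists>x\<in>D. clean_trace C n \<omega> I x)" for \<omega> I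
  proof
    assume "\<exists>x\<in>S. clean_trace C n \<omega> I x"
    moreover have "open {x. clean_trace C n \<omega> I x}"
    proof -
      have "{x. clean_trace C n \<omega> I x} = (\<Inter>i\<in>{..<n}. (\<lambda>x. \<omega> i - x) -` (if i \<in> I then C else - closure C))"
        by (auto simp: clean_trace_def split: if_splits)
      also have "open \<dots>"
        using assms(1) by (intro open_INT ballI open_vimage) (auto intro!: continuous_intros)
      finally show ?thesis .
    qed
    ultimately have "{x. clean_trace C n \<omega> I x} \<inter> closure D \<noteq> {}" using D(3) by auto
    then show "\<exists>x\<in>D. clean_trace C n \<omega> I x"
      using open_Int_closure_eq_empty[OF \<open>open {x. clean_trace C n \<omega> I x}\<close>, of D] by auto
  qed (use D(2) in auto)
  have [measurable_cong]: "sets U = sets borel" by fact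
  have m1[measurable]: "Measurable.pred ?M (\<lambda>\<omega>. clean_trace C n \<omega> I x)" for I x
  proof -
    have [measurable]: "C \<in> sets borel" using assms(1) by simp
    have [measurable]: "closure C \<in> sets borel" by simp
    have [measurable]: "Measurable.pred ?M (\<lambda>\<omega>. \<omega> i - x \<in> C)" 
         "Measurable.pred ?M (\<lambda>\<omega>. \<omega> i - x \<in> - closure C)" if "i \<in> {..<n}" for i
      using that by measurable
    have "Measurable.pred ?M (\<lambda>\<omega>. \<forall>i\<in>{..<n}. if i \<in> I then \<omega> i - x \<in> C else \<omega> i - x \<in> - closure C)"
      by (intro pred_intros_finite) auto
    then show ?thesis by (simp add: clean_trace_def Ball_def)
  qed
  have [measurable]: "Measurable.pred ?M (\<lambda>\<omega>. \<exists>x\<in>D. clean_trace C n \<omega> I x)" for I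
    unfolding pred_def by (rule sets.sets_Collect_countable_Ex'[OF _ D(1)]) (rule m1[unfolded pred_def])
  have m2[measurable]: "Measurable.pred ?M (\<lambda>\<omega>. card (\<omega> ` I) = k)" if I: "I \<subseteq> {..<n}" for I
  proof -
    have fin: "finite I" using I finite_subset by blast
    have eq: "Measurable.pred ?M (\<lambda>\<omega>. \<omega> i = \<omega> j)" if "i \<in> I" "j \<in> I" for i j
      unfolding pred_def by (rule measurable_equality_set) (use that I sets in \<open>auto intro!: measurable_PiM_component_rev measurable_ident_sets\<close>)
    have finJ: "finite J" if "J \<in> Pow I" for J using that fin finite_subset by blast
    show ?thesis unfolding card_image_eq_iff_section[OF fin]
      by (intro pred_intros_finite pred_intros_logic eq finJ fin) (use fin in auto)
  qed
  have "(\<lambda>\<omega>. real (num_k_sets_within A C k (\<omega> ` {..<n}))) =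
    (\<lambda>\<omega>. \<Sum>I\<in>Pow {..<n}. if (\<exists>x\<in>D. clean_trace C n \<omega> I x) \<and> card (\<omega> ` I) = k then 1 else 0)"
    unfolding num_k_sets_within_eq_sum[OF assms(1)] S_def[symmetric] dense
    by (auto simp: of_bool_def intro!: ext sum.cong)
  also have "\<dots> \<in> borel_measurable ?M"
  proof (intro borel_measurable_sum)
    fix I assume "I \<in> Pow {..<n}"
    then have [measurable]: "Measurable.pred ?M (\<lambda>\<omega>. card (\<omega> ` I) = k)" by (intro m2) simp
    show "(\<lambda>\<omega>. if (\<exists>x\<in>D. clean_trace C n \<omega> I x) \<and> card (\<omega> ` I) = k then 1 else 0) \<in> borel_measurable ?M"
      by measurable
  qed
  finally show ?thesis .
qed

section \<open>A lower bound for the expected number of subsets\<close>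

lemma finite_trace_family: "finite X \<Longrightarrow> finite {X \<inter> f x | x. P x}"
  by (rule finite_subset[of _ "Pow X"]) auto

lemma num_k_sets_within_mono:
  assumes "finite X" "A \<subseteq> B"
  shows "num_k_sets_within A C k X \<le> num_k_sets_within B C k X"
  unfolding num_k_sets_within_def
  by (rule card_mono[OF finite_trace_family[OF assms(1)]]) (use assms(2) in blast)

lemma num_k_sets_eq_within_UNIV: "num_k_sets C k X = num_k_sets_within UNIV C k X"
proof -
  have "k_sets (translates C) k X = {X \<inter> (+) x ` C | x.
      (+) x ` C \<subseteq> UNIV \<and> card (X \<inter> (+) x ` C) = k \<and> X \<inter> frontier ((+) x ` C) = {}}"
    unfolding k_sets_def translates_def by blast
  then show ?thesis
    by (simp only: num_k_sets_def num_k_sets_within_def)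
qed

lemma num_k_sets_within_le_power:
  fixes \<omega> :: "nat \<Rightarrow> real^2"
  shows "num_k_sets_within A C k (\<omega> ` {..<n}) \<le> 2 ^ n"
proof -
  have "num_k_sets_within A C k (\<omega> ` {..<n}) \<le> card (Pow (\<omega> ` {..<n}))"
    unfolding num_k_sets_within_def by (rule card_mono) auto
  also have "\<dots> \<le> 2 ^ n" using card_image_le[of "{..<n}" \<omega>] by (simp add: card_Pow)
  finally show ?thesis .
qed

lemma sum_num_k_sets_within_ge:
  assumes "finite X" and "finite W"
    and "\<And>x. x \<in> G \<Longrightarrow> (+) x ` C \<subseteq> A"
    and "\<And>x. x \<in> G \<Longrightarrow> X \<inter> frontier ((+) x ` C) = {}"
    and "\<And>x. x \<in> G \<Longrightarrow> card (X \<inter> (+) x ` C) \<in> W"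
    and inj: "inj_on (\<lambda>x. X \<inter> (+) x ` C) G"
  shows "card G \<le> (\<Sum>k\<in>W. num_k_sets_within A C k X)"
proof -
  let ?F = "\<lambda>k. {X \<inter> (+) x ` C | x.
      (+) x ` C \<subseteq> A \<and> card (X \<inter> (+) x ` C) = k \<and> X \<inter> frontier ((+) x ` C) = {}}"
  have "card G = card ((\<lambda>x. X \<inter> (+) x ` C) ` G)" by (rule card_image[OF inj, symmetric])
  also have "\<dots> \<le> card (\<Union>k\<in>W. ?F k)"
  proof (rule card_mono)
    show "finite (\<Union>k\<in>W. ?F k)" using assms(2) finite_trace_family[OF assms(1)] by (rule finite_UN_I)
    show "(\<lambda>x. X \<inter> (+) x ` C) ` G \<subseteq> (\<Union>k\<in>W. ?F k)"
    proof (intro image_subsetI UN_I)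
      fix x assume "x \<in> G"
      from assms(3-5)[OF this] show "card (X \<inter> (+) x ` C) \<in> W" "X \<inter> (+) x ` C \<in> ?F (card (X \<inter> (+) x ` C))"
        by blast+
    qed
  qed
  also have "\<dots> \<le> (\<Sum>k\<in>W. card (?F k))" by (rule card_UN_le[OF assms(2)])
  finally show ?thesis by (simp add: num_k_sets_within_def)
qed

locale uniform_points =
  fixes C A :: "(real^2) set" and p :: real
  assumes openC: "open C" and convexC: "convex C" and compactA: "compact A"
    and areaC: "0 < area C" and areaA: "0 < area A"
    and p: "p = area C / area A"
begin

abbreviation "U \<equiv> uniform_measure lborel A"

lemma emeasure_A: "emeasure lborel A \<noteq> 0" "emeasure lborel A \<noteq> \<infinity>"
  using areaA emeasure_compact_finite[OF compactA] by (auto simp: measure_def)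

lemma prob_space_U: "prob_space U"
  using emeasure_A by (rule prob_space_uniform_measure)

lemma prob_space_iid: "prob_space (iid_uniform A n)"
  unfolding iid_uniform_def by (intro prob_space_PiM prob_space_U)

lemma integrable_num_k_sets_within:
  "integrable (iid_uniform A n) (\<lambda>\<omega>. real (num_k_sets_within B C k (\<omega> ` {..<n})))"
proof -
  interpret prob_space "iid_uniform A n" by (rule prob_space_iid)
  show ?thesis
  proof (rule integrable_const_bound[of _ "2 ^ n"])
    have "real (num_k_sets_within B C k (\<omega> ` {..<n})) \<le> 2 ^ n" for \<omega> :: "nat \<Rightarrow> real^2"
      using num_k_sets_within_le_power[of B C k \<omega> n] by (metis of_nat_le_iff of_nat_numeral of_nat_power)
    then show "AE \<omega> in iid_uniform A n. norm (real (num_k_sets_within B C k (\<omega> ` {..<n}))) \<le> 2 ^ n"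
      by simp
    show "(\<lambda>\<omega>. real (num_k_sets_within B C k (\<omega> ` {..<n}))) \<in> borel_measurable (iid_uniform A n)"
      unfolding iid_uniform_def by (rule num_k_sets_within_measurable[OF openC]) simp
  qed
qed

lemma expected_num_k_sets_ge:
  "expected A n (num_k_sets_within A C k) \<le> expected A n (num_k_sets C k)"
  unfolding expected_def num_k_sets_eq_within_UNIV
proof (intro integral_mono integrable_num_k_sets_within)
  show "real (num_k_sets_within A C k (\<omega> ` {..<n})) \<le> real (num_k_sets_within UNIV C k (\<omega> ` {..<n}))"
    for \<omega> :: "nat \<Rightarrow> real^2"
    by (intro of_nat_mono num_k_sets_within_mono) auto
qed

lemma AE_avoid_null:
  assumes "N \<in> null_sets lborel"
  shows "AE \<omega> in iid_uniform A n. \<forall>i<n. \<omega> i \<notin> N"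
proof -
  have "AE x in U. x \<notin> N"
    using AE_not_in[OF assms] compactA by (intro AE_uniform_measureI) (auto intro: borel_compact)
  then have "AE \<omega> in PiM {..<n} (\<lambda>_. U). \<omega> i \<notin> N" if "i < n" for i
    using that by (intro AE_PiM_component prob_space_U) auto
  then have "AE \<omega> in PiM {..<n} (\<lambda>_. U). \<forall>i\<in>{..<n}. \<omega> i \<notin> N"
    by (intro AE_finite_allI) auto
  then show ?thesis unfolding iid_uniform_def by (simp add: Ball_def)
qed

text \<open>
  Outside a bad event, the translates by \<open>G\<close> cut out \<open>card G\<close> different subsets with sizes in the
  window \<open>W\<close>. The bad event is that the difference of two translates contains no point or that the
  number of points in some translate deviates too much; the union bound gives the two error terms.
\<close>
lemma sum_expected_ge:
  assumes fin: "finite G" and inside: "\<And>x. x \<in> G \<Longrightarrow> (+) x ` C \<subseteq> A"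
    and sep: "\<And>x y. x \<in> G \<Longrightarrow> y \<in> G \<Longrightarrow> x \<noteq> y \<Longrightarrow> q \<le> area ((+) x ` C - (+) y ` C) / area A"
    and "0 < n" "0 \<le> \<epsilon>" and W: "finite W" "\<And>k. \<bar>real k - p * real n\<bar> < \<epsilon> \<Longrightarrow> k \<in> W"
  shows "real (card G) * (1 - real (card G)^2 * exp (- q * real n) - 2 * real (card G) * exp (- 2 * \<epsilon>\<^sup>2 / real n))
    \<le> (\<Sum>k\<in>W. expected A n (num_k_sets_within A C k))"
proof -
  let ?M = "iid_uniform A n"
  interpret P: prob_space ?M by (rule prob_space_iid)
  interpret U: prob_space U by (rule prob_space_U)
  have bor: "(+) x ` C \<in> sets borel" for x
    by (intro borel_open open_translation openC)
  have U_measure: "measure U S = area S / area A" if "S \<in> sets borel" "S \<subseteq> A" for S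
    using that emeasure_A by (subst measure_uniform_measure) (simp_all add: Int_absorb1)
  define Miss where "Miss xy = {\<omega> \<in> space ?M. \<forall>i<n. \<omega> i \<notin> (+) (fst xy) ` C - (+) (snd xy) ` C}" for xy
  define Dev where "Dev x = {\<omega> \<in> space ?M. \<epsilon> \<le> \<bar>real (card {i. i < n \<and> \<omega> i \<in> (+) x ` C}) - p * real n\<bar>}" for x
  \<comment> \<open>Ordered pairs suffice: the first translate must contain a point that the second one misses.\<close>
  let ?D = "{xy \<in> G \<times> G. fst xy \<noteq> snd xy}"
  have finD: "finite ?D" "card ?D \<le> (card G)^2"
  proof -
    show "finite ?D" using fin by auto
    have "card ?D \<le> card (G \<times> G)" using fin by (intro card_mono) auto
    then show "card ?D \<le> (card G)^2" by (simp add: power2_eq_square card_cartesian_product)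
  qed
  have Miss: "Miss xy \<in> P.events" "P.prob (Miss xy) \<le> exp (- q * real n)" if "xy \<in> ?D" for xy
  proof -
    let ?B = "(+) (fst xy) ` C - (+) (snd xy) ` C"
    have [measurable]: "?B \<in> sets U" using bor by auto
    show "Miss xy \<in> P.events" unfolding Miss_def iid_uniform_def
      using \<open>?B \<in> sets U\<close> by measurable
    have "fst xy \<in> G" using that by auto
    then have "?B \<subseteq> A" using inside by blast
    then have "measure U ?B = area ?B / area A" using bor by (intro U_measure sets.Diff)
    moreover have "q \<le> area ?B / area A" using that by (intro sep) auto
    ultimately have "q \<le> measure U ?B" by (simp only:)
    then have "1 - measure U ?B \<le> exp (- q)"
      using exp_ge_add_one_self[of "- q"] by linarith
    then have "(1 - measure U ?B) ^ n \<le> exp (- q) ^ n"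
      by (intro power_mono) (auto simp: U.prob_le_1)
    moreover have "P.prob (Miss xy) = (1 - measure U ?B) ^ n"
      unfolding Miss_def iid_uniform_def
      by (rule prob_all_points_avoid[OF prob_space_U]) fact
    ultimately show "P.prob (Miss xy) \<le> exp (- q * real n)"
      by (simp add: exp_of_nat_mult[symmetric] mult.commute)
  qed
  have Dev: "Dev x \<in> P.events" "P.prob (Dev x) \<le> 2 * exp (- 2 * \<epsilon>\<^sup>2 / real n)" if "x \<in> G" for x
  proof -
    have "area ((+) x ` C) = area C" using openC by (intro measure_lborel_translation) simp
    then have "measure U ((+) x ` C) = p"
      using inside[OF that] bor by (simp add: U_measure p)
    then show "P.prob (Dev x) \<le> 2 * exp (- 2 * \<epsilon>\<^sup>2 / real n)"
      using prob_count_deviation[OF prob_space_U, of "(+) x ` C" \<epsilon> n] bor \<open>0 < n\<close> \<open>0 \<le> \<epsilon>\<close>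
      by (simp add: Dev_def iid_uniform_def)
    have "(\<lambda>\<omega>. card {i. i < n \<and> \<omega> i \<in> (+) x ` C}) = (\<lambda>\<omega>. \<Sum>i<n. if \<omega> i \<in> (+) x ` C then 1 else 0)"
      by (simp add: sum.inter_filter[symmetric] fun_eq_iff)
    moreover have "(\<lambda>\<omega>. real (\<Sum>i<n. if \<omega> i \<in> (+) x ` C then 1 else 0)) \<in> borel_measurable ?M"
      unfolding iid_uniform_def of_nat_sum using bor[of x]
      by measurable
    ultimately have [measurable]: "(\<lambda>\<omega>. real (card {i. i < n \<and> \<omega> i \<in> (+) x ` C})) \<in> borel_measurable ?M"
      by metis
    show "Dev x \<in> P.events" unfolding Dev_def by measurable
  qed
  define Bad where "Bad = (\<Union>xy\<in>?D. Miss xy) \<union> (\<Union>x\<in>G. Dev x)"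
  have Bad[measurable]: "Bad \<in> P.events"
    unfolding Bad_def using Miss(1) Dev(1) fin finD by (intro sets.Un sets.finite_UN) auto
  have "P.prob Bad \<le> P.prob (\<Union>xy\<in>?D. Miss xy) + P.prob (\<Union>x\<in>G. Dev x)"
    unfolding Bad_def using Miss(1) Dev(1) fin finD by (intro measure_Un_le sets.finite_UN) auto
  also have "P.prob (\<Union>xy\<in>?D. Miss xy) \<le> (\<Sum>xy\<in>?D. P.prob (Miss xy))"
    using Miss(1) finD by (intro measure_UNION_le) auto
  also have "\<dots> \<le> real (card ?D) * exp (- q * real n)"
    using Miss(2) by (intro sum_bounded_above) auto
  also have "\<dots> \<le> real (card G)^2 * exp (- q * real n)"
    using finD(2) by (intro mult_right_mono) (auto simp flip: of_nat_power)
  also have "P.prob (\<Union>x\<in>G. Dev x) \<le> (\<Sum>x\<in>G. P.prob (Dev x))"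
    using Dev(1) fin by (intro measure_UNION_le) auto
  also have "\<dots> \<le> real (card G) * (2 * exp (- 2 * \<epsilon>\<^sup>2 / real n))"
    using Dev(2) by (intro sum_bounded_above) auto
  finally have probBad: "P.prob Bad \<le> real (card G)^2 * exp (- q * real n) + 2 * real (card G) * exp (- 2 * \<epsilon>\<^sup>2 / real n)"
    by (simp add: algebra_simps)
  have AE1: "AE \<omega> in ?M. inj_on \<omega> {..<n}"
  proof -
    have "emeasure U {x} = 0" for x
    proof -
      have "emeasure lborel (A \<inter> {x}) \<le> emeasure lborel {x}" by (intro emeasure_mono) auto
      then show ?thesis using borel_compact[OF compactA] by simp
    qed
    then show ?thesis unfolding iid_uniform_def
      by (intro AE_points_distinct prob_space_U) auto
  qed
  have AE2: "AE \<omega> in ?M. \<forall>x\<in>G. \<forall>i<n. \<omega> i \<notin> frontier ((+) x ` C)"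
    using fin convexC
    by (intro AE_finite_allI AE_avoid_null frontier_convex_null convex_translation)
  have "AE \<omega> in ?M. real (card G) * indicator (space ?M - Bad) \<omega>
      \<le> (\<Sum>k\<in>W. real (num_k_sets_within A C k (\<omega> ` {..<n})))"
    using AE1 AE2 AE_space
  proof eventually_elim
    case (elim \<omega>)
    show ?case
    proof (cases "\<omega> \<in> Bad")
      case False
      let ?X = "\<omega> ` {..<n}"
      have "card G \<le> (\<Sum>k\<in>W. num_k_sets_within A C k ?X)"
      proof (rule sum_num_k_sets_within_ge)
        show "?X \<inter> frontier ((+) x ` C) = {}" if "x \<in> G" for x
          using elim(2) that by auto
        show "card (?X \<inter> (+) x ` C) \<in> W" if "x \<in> G" for x
        proof (rule W(2))
          have "?X \<inter> (+) x ` C = \<omega> ` {i. i < n \<and> \<omega> i \<in> (+) x ` C}" by blast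
          moreover have "inj_on \<omega> {i. i < n \<and> \<omega> i \<in> (+) x ` C}"
            using elim(1) by (rule inj_on_subset) auto
          ultimately have "card (?X \<inter> (+) x ` C) = card {i. i < n \<and> \<omega> i \<in> (+) x ` C}"
            by (simp only: card_image)
          moreover have "\<omega> \<notin> Dev x" using False that by (auto simp: Bad_def)
          ultimately show "\<bar>real (card (?X \<inter> (+) x ` C)) - p * real n\<bar> < \<epsilon>"
            using elim(3) by (simp add: Dev_def)
        qed
        show "inj_on (\<lambda>x. ?X \<inter> (+) x ` C) G"
        proof (rule inj_onI, rule ccontr)
          fix x y assume xy: "x \<in> G" "y \<in> G" "?X \<inter> (+) x ` C = ?X \<inter> (+) y ` C" "x \<noteq> y"
          then have "\<omega> \<notin> Miss (x, y)" using False by (auto simp: Bad_def)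
          then obtain i where "i < n" "\<omega> i \<in> (+) x ` C" "\<omega> i \<notin> (+) y ` C"
            using elim(3) unfolding Miss_def by auto
          then show False using xy(3) by blast
        qed
      qed (use W inside in auto)
      then have "real (card G) \<le> real (\<Sum>k\<in>W. num_k_sets_within A C k ?X)" by (rule of_nat_mono)
      moreover have "real (card G) * indicator (space ?M - Bad) \<omega> \<le> real (card G)"
        by (simp add: indicator_def)
      ultimately show ?thesis by (simp only: of_nat_sum)
    qed (simp add: sum_nonneg)
  qed
  then have "(\<integral>\<omega>. real (card G) * indicator (space ?M - Bad) \<omega> \<partial>?M)
      \<le> (\<integral>\<omega>. (\<Sum>k\<in>W. real (num_k_sets_within A C k (\<omega> ` {..<n}))) \<partial>?M)"
    by (intro integral_mono_AE Bochner_Integration.integrable_sum integrable_num_k_sets_within)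
       (auto intro!: P.integrable_const_bound[of _ "real (card G)"] simp: indicator_def)
  also have "\<dots> = (\<Sum>k\<in>W. expected A n (num_k_sets_within A C k))"
    unfolding expected_def by (intro Bochner_Integration.integral_sum integrable_num_k_sets_within)
  also have "(\<integral>\<omega>. real (card G) * indicator (space ?M - Bad) \<omega> \<partial>?M) = real (card G) * (1 - P.prob Bad)"
    by (simp add: P.prob_compl)
  finally have "real (card G) * (1 - P.prob Bad) \<le> (\<Sum>k\<in>W. expected A n (num_k_sets_within A C k))" .
  moreover have "real (card G) * (1 - real (card G)^2 * exp (- q * real n) - 2 * real (card G) * exp (- 2 * \<epsilon>\<^sup>2 / real n))
      \<le> real (card G) * (1 - P.prob Bad)"
    using probBad by (intro mult_left_mono) auto
  ultimately show ?thesis by (rule order_trans[rotated])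
qed

end

section \<open>The grid of translates and the choice of its mesh\<close>

text \<open>
  The grid has mesh \<open>r / (2M)\<close>, so both coordinates of the offset from \<open>a\<close> are below \<open>r / 2\<close>.
\<close>
lemma grid_in_ball:
  fixes a :: "real^2" and r :: real
  assumes "0 < r" "0 < M"
  obtains G where "finite G" "card G = M\<^sup>2" "G \<subseteq> ball a r"
    "\<And>x y. x \<in> G \<Longrightarrow> y \<in> G \<Longrightarrow> x \<noteq> y \<Longrightarrow> r / (2 * real M) \<le> norm (y - x)"
proof -
  define \<delta> where "\<delta> = r / (2 * real M)"
  have \<delta>: "0 < \<delta>" "2 * real M * \<delta> = r" using assms by (auto simp: \<delta>_def)
  define g :: "nat \<times> nat \<Rightarrow> real^2" where "g ij = a + \<delta> *\<^sub>R vector [real (fst ij), real (snd ij)]" for ij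
  have g: "g ij $ 1 = a $ 1 + \<delta> * real (fst ij)" "g ij $ 2 = a $ 2 + \<delta> * real (snd ij)" for ij
    by (simp_all add: g_def)
  have sep: "\<delta> \<le> norm (g ij - g kl)" if "ij \<noteq> kl" for ij kl
  proof -
    have *: "\<delta> \<le> \<bar>\<delta> * real m - \<delta> * real n\<bar>" if "m \<noteq> n" for m n :: nat
    proof -
      have "1 \<le> \<bar>real m - real n\<bar>" using that by linarith
      then have "\<delta> * 1 \<le> \<delta> * \<bar>real m - real n\<bar>" using \<delta>(1) by (intro mult_left_mono) auto
      also have "\<dots> = \<bar>\<delta> * real m - \<delta> * real n\<bar>" using \<delta>(1) by (simp add: abs_mult flip: right_diff_distrib)
      finally show ?thesis by simp
    qed
    from that consider "fst ij \<noteq> fst kl" | "snd ij \<noteq> snd kl" by (auto simp: prod_eq_iff)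
    then show ?thesis
    proof cases
      case 1
      have "\<delta> \<le> \<bar>(g ij - g kl) $ 1\<bar>" using *[OF 1] by (simp add: g)
      also have "\<dots> \<le> norm (g ij - g kl)" by (rule component_le_norm_cart)
      finally show ?thesis .
    next
      case 2
      have "\<delta> \<le> \<bar>(g ij - g kl) $ 2\<bar>" using *[OF 2] by (simp add: g)
      also have "\<dots> \<le> norm (g ij - g kl)" by (rule component_le_norm_cart)
      finally show ?thesis .
    qed
  qed
  let ?I = "{..<M} \<times> {..<M}"
  have inj: "inj_on g ?I"
  proof (rule inj_onI, rule ccontr)
    fix x y assume "g x = g y" "x \<noteq> y"
    then show False using sep[of x y] \<delta>(1) by simp
  qed
  show ?thesis
  proof
    show "finite (g ` ?I)" by simp
    show "card (g ` ?I) = M\<^sup>2"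
      using inj by (simp add: card_image card_cartesian_product power2_eq_square)
    show "g ` ?I \<subseteq> ball a r"
    proof
      fix x assume "x \<in> g ` ?I"
      then obtain i j where ij: "x = g (i, j)" "i < M" "j < M" by auto
      have "norm (x - a) \<le> \<bar>(x - a) $ 1\<bar> + \<bar>(x - a) $ 2\<bar>"
        using norm_le_l1_cart[of "x - a"] by (simp add: sum_2)
      also have "\<dots> = \<delta> * (real i + real j)" using \<delta>(1) by (simp add: ij(1) g distrib_left)
      also have "\<dots> < \<delta> * (2 * real M)" using \<delta>(1) ij by (intro mult_strict_left_mono) auto
      also have "\<dots> = r" using \<delta>(2) by (simp add: mult.commute)
      finally show "x \<in> ball a r" by (simp add: dist_norm norm_minus_commute)
    qed
    show "r / (2 * real M) \<le> norm (y - x)" if "x \<in> g ` ?I" "y \<in> g ` ?I" "x \<noteq> y" for x y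
      using that sep unfolding \<delta>_def by (metis (no_types, lifting) imageE)
  qed
qed

lemma nats_in_window:
  fixes c \<epsilon> :: real
  assumes "0 \<le> \<epsilon>"
  shows "finite {k::nat. \<bar>real k - c\<bar> < \<epsilon>}" "real (card {k::nat. \<bar>real k - c\<bar> < \<epsilon>}) \<le> 2 * \<epsilon> + 1"
proof -
  let ?W = "{k::nat. \<bar>real k - c\<bar> < \<epsilon>}" and ?Z = "{\<lceil>c - \<epsilon>\<rceil>..\<lfloor>c + \<epsilon>\<rfloor>}"
  have sub: "int ` ?W \<subseteq> ?Z" by (auto simp: ceiling_le_iff le_floor_iff abs_less_iff)
  then show fin: "finite ?W"
    by (rule finite_imageD[OF finite_subset]) (auto simp: inj_on_def)
  have "card ?W = card (int ` ?W)" by (simp add: card_image)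
  also have "\<dots> \<le> card ?Z" using sub by (intro card_mono) auto
  finally have "real (card ?W) \<le> real (nat (\<lfloor>c + \<epsilon>\<rfloor> - \<lceil>c - \<epsilon>\<rceil> + 1))" by simp
  also have "\<dots> \<le> 2 * \<epsilon> + 1" using assms by linarith
  finally show "real (card ?W) \<le> 2 * \<epsilon> + 1" .
qed

lemma exists_term_ge_average:
  fixes f :: "'a \<Rightarrow> real"
  assumes "finite W" "real (card W) \<le> w" "0 < T" "T \<le> (\<Sum>k\<in>W. f k)"
  shows "\<exists>k\<in>W. T / w \<le> f k"
proof (rule ccontr)
  have "W \<noteq> {}" using assms by auto
  then have w: "0 < w" using assms(1,2) by (meson card_gt_0_iff less_le_trans of_nat_0_less_iff)
  assume "\<not> ?thesis"
  then have "(\<Sum>k\<in>W. f k) < (\<Sum>k\<in>W. T / w)"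
    using assms(1) \<open>W \<noteq> {}\<close> by (intro sum_strict_mono) auto
  also have "\<dots> \<le> w * (T / w)" using assms(2,3) w by (simp del: times_divide_eq_right add: mult_right_mono)
  finally show False using assms(4) w by simp
qed

context uniform_points
begin

text \<open>
  The hypothesis on \<open>M\<close> keeps the error terms of \<open>sum_expected_ge\<close> below \<open>1/2\<close>, so the \<open>M\<^sup>2\<close> grid
  translates yield a total expectation of at least \<open>M\<^sup>2 / 2\<close>. This total is shared among at most
  \<open>2 \<epsilon> + 1\<close> sizes.
\<close>
lemma exists_k_expected_ge:
  assumes bdd: "bounded C" and dbl: "(\<lambda>y. 2 *\<^sub>R y) ` C \<subseteq> A"
  obtains c1 where "0 < c1"
    "\<And>M n \<epsilon>. 0 < M \<Longrightarrow> 0 < n \<Longrightarrow> 0 \<le> \<epsilon> \<Longrightarrow>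
      real M ^ 4 * exp (- c1 * real n / real M) + 2 * real M ^ 2 * exp (- 2 * \<epsilon>\<^sup>2 / real n) \<le> 1 / 2 \<Longrightarrow>
      \<exists>k. \<bar>real k - p * real n\<bar> < \<epsilon> \<and>
        real M ^ 2 / (2 * (2 * \<epsilon> + 1)) \<le> expected A n (num_k_sets_within A C k)"
proof -
  have "C \<noteq> {}" using areaC by auto
  then obtain a r where r: "0 < r" "ball a r \<subseteq> C"
    using openC by (meson ex_in_conv open_contains_ball)
  obtain d where d: "0 < d" "\<And>x y. x \<in> C \<Longrightarrow> y \<in> C \<Longrightarrow> dist x y \<le> d"
  proof
    show "dist x y \<le> diameter C + 1" if "x \<in> C" "y \<in> C" for x y
      using diameter_bounded_bound[OF bdd that] by simp
    show "0 < diameter C + 1" using diameter_ge_0[OF bdd] by simp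
  qed
  \<comment> \<open>Grid vectors are at distance at least \<open>r / (2M)\<close>, so the covering bound gives the proportion \<open>c1 / M\<close> of \<open>A\<close>.\<close>
  define c1 where "c1 = p * r / (4 * d)"
  have "0 < p" using areaC areaA p by simp
  show ?thesis
  proof
    show "0 < c1" using \<open>0 < p\<close> r d by (simp add: c1_def)
    fix M n :: nat and \<epsilon> :: real
    assume M: "0 < M" and n: "0 < n" and \<epsilon>: "0 \<le> \<epsilon>"
      and small: "real M ^ 4 * exp (- c1 * real n / real M) + 2 * real M ^ 2 * exp (- 2 * \<epsilon>\<^sup>2 / real n) \<le> 1 / 2"
    obtain G where G: "finite G" "card G = M\<^sup>2" "G \<subseteq> ball a r"
      "\<And>x y. x \<in> G \<Longrightarrow> y \<in> G \<Longrightarrow> x \<noteq> y \<Longrightarrow> r / (2 * real M) \<le> norm (y - x)"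
      using grid_in_ball[OF r(1) M, of a] by blast
    have GC: "G \<subseteq> C" using G(3) r(2) by blast
    let ?W = "{k::nat. \<bar>real k - p * real n\<bar> < \<epsilon>}"
    have sum: "real (card G) * (1 - real (card G)^2 * exp (- (c1 / real M) * real n) - 2 * real (card G) * exp (- 2 * \<epsilon>\<^sup>2 / real n))
      \<le> (\<Sum>k\<in>?W. expected A n (num_k_sets_within A C k))"
    proof (rule sum_expected_ge)
      show "(+) x ` C \<subseteq> A" if "x \<in> G" for x
      proof
        \<comment> \<open>\<open>x + y\<close> is twice the midpoint of \<open>x\<close> and \<open>y\<close>, and \<open>C\<close> is convex.\<close>
        fix z assume "z \<in> (+) x ` C"
        then obtain y where y: "y \<in> C" "z = x + y" by auto
        have "(1/2) *\<^sub>R x + (1/2) *\<^sub>R y \<in> C"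
          using convexC GC that y(1) by (intro convexD) auto
        moreover have "z = 2 *\<^sub>R ((1/2) *\<^sub>R x + (1/2) *\<^sub>R y)" using y(2) by (simp add: scaleR_add_right)
        ultimately show "z \<in> A" using dbl by blast
      qed
      show "c1 / real M \<le> area ((+) x ` C - (+) y ` C) / area A" if "x \<in> G" "y \<in> G" "x \<noteq> y" for x y
      proof -
        have "norm (y - x) \<le> d" using d(2)[of x y] that GC by (auto simp: dist_norm norm_minus_commute)
        have "c1 / real M = area C * (r / (2 * real M)) / (2 * d) / area A"
          using M d by (simp add: c1_def p)
        also have "\<dots> \<le> area C * norm (y - x) / (2 * d) / area A"
          using G(4)[OF that] areaC areaA d by (intro divide_right_mono mult_left_mono) auto
        also have "\<dots> \<le> area (C - (+) (y - x) ` C) / area A"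
          using areaA that \<open>norm (y - x) \<le> d\<close> d(2)
          by (intro divide_right_mono area_translate_difference_lower_bound openC bdd) auto
        also have "area (C - (+) (y - x) ` C) = area ((+) x ` (C - (+) (y - x) ` C))"
          using openC by (intro measure_lborel_translation[symmetric] sets.Diff borel_open open_translation)
        also have "(+) x ` (C - (+) (y - x) ` C) = (+) x ` C - (+) y ` C"
          by (subst image_set_diff) (auto simp: image_image)
        finally show ?thesis .
      qed
      show "finite G" "0 < n" "0 \<le> \<epsilon>" "finite ?W" by (fact G(1) n \<epsilon> nats_in_window(1)[OF \<epsilon>])+
      show "k \<in> ?W" if "\<bar>real k - p * real n\<bar> < \<epsilon>" for k using that by simp
    qed
    have "real M ^ 2 / 2 \<le> real (card G) * (1 - real (card G)^2 * exp (- (c1 / real M) * real n) - 2 * real (card G) * exp (- 2 * \<epsilon>\<^sup>2 / real n))"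
    proof -
      have c: "real (card G) = real M ^ 2" "(real M ^ 2)\<^sup>2 = real M ^ 4"
        by (simp_all add: G(2) power2_eq_square power4_eq_xxxx mult.assoc)
      have e: "- (c1 / real M) * real n = - c1 * real n / real M" by simp
      have "1 / 2 \<le> 1 - real M ^ 4 * exp (- c1 * real n / real M) - 2 * real M ^ 2 * exp (- 2 * \<epsilon>\<^sup>2 / real n)"
        using small by linarith
      then have "real M ^ 2 * (1 / 2) \<le> real M ^ 2 * (1 - real M ^ 4 * exp (- c1 * real n / real M) - 2 * real M ^ 2 * exp (- 2 * \<epsilon>\<^sup>2 / real n))"
        by (rule mult_left_mono) simp
      then show ?thesis unfolding c e by (simp only: mult_1_right times_divide_eq_right)
    qed
    with sum have "real M ^ 2 / 2 \<le> (\<Sum>k\<in>?W. expected A n (num_k_sets_within A C k))" by (rule order_trans[rotated])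
    moreover have "0 < real M ^ 2 / 2" using M by simp
    ultimately have "\<exists>k\<in>?W. real M ^ 2 / 2 / (2 * \<epsilon> + 1) \<le> expected A n (num_k_sets_within A C k)"
      using exists_term_ge_average[OF nats_in_window[OF \<epsilon>]] by blast
    then show "\<exists>k. \<bar>real k - p * real n\<bar> < \<epsilon> \<and>
        real M ^ 2 / (2 * (2 * \<epsilon> + 1)) \<le> expected A n (num_k_sets_within A C k)"
      by auto
  qed
qed

end

text \<open>
  The choice is \<open>M = \<lfloor>\<beta> n / ln n\<rfloor>\<close>. The factor \<open>\<beta> \<le> c1 / 5\<close> gives \<open>exp (- c1 n / M) \<le> n\<^bsup>-5\<^esup>\<close>,
  one power better than \<open>M\<^sup>4 \<le> n\<^sup>4\<close>; and \<open>\<epsilon>\<^sup>2 = n ln n\<close> makes the second error term at most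
  \<open>2 M\<^sup>2 n\<^bsup>-2\<^esup> \<le> 2 / (ln n)\<^sup>2\<close>. Either error term is eventually at most \<open>1/4\<close>.
\<close>
lemma grid_size_asymptotics:
  fixes c1 :: real
  assumes "0 < c1"
  obtains b and M :: "nat \<Rightarrow> nat" where "0 < b"
    "\<forall>\<^sub>F n in sequentially. 0 < M n \<and> 0 < n \<and> 0 \<le> sqrt (real n * ln (real n)) \<and>
      real (M n) ^ 4 * exp (- c1 * real n / real (M n))
        + 2 * real (M n) ^ 2 * exp (- 2 * (sqrt (real n * ln (real n)))\<^sup>2 / real n) \<le> 1 / 2 \<and>
      b * (real n powr (3/2) / ln (real n) powr (5/2)) \<le> real (M n) ^ 2 / (2 * (2 * sqrt (real n * ln (real n)) + 1))"
proof -
  define \<beta> where "\<beta> = min 1 (c1 / 5)"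
  have \<beta>: "0 < \<beta>" "\<beta> \<le> 1" "5 * \<beta> \<le> c1" using assms by (auto simp: \<beta>_def min_def)
  define M where "M n = nat \<lfloor>\<beta> * real n / ln (real n)\<rfloor>" for n
  \<comment> \<open>The first bound gives \<open>\<beta> n / ln n \<ge> 2\<close>, so that rounding down loses at most a factor \<open>2\<close>.\<close>
  have e1: "\<forall>\<^sub>F n in sequentially. 2 / \<beta> \<le> real n / ln (real n)"
    by real_asymp
  have e2: "\<forall>\<^sub>F n in sequentially. 1 \<le> real n * ln (real n)" by real_asymp
  have e3: "\<forall>\<^sub>F n in sequentially. 3 \<le> ln (real n)" by real_asymp
  have e4: "\<forall>\<^sub>F n in sequentially. 4 \<le> real n" by real_asymp
  show ?thesis
  proof
    show "0 < \<beta>\<^sup>2 / 24" using \<beta> by simp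
    show "\<forall>\<^sub>F n in sequentially. 0 < M n \<and> 0 < n \<and> 0 \<le> sqrt (real n * ln (real n)) \<and>
      real (M n) ^ 4 * exp (- c1 * real n / real (M n))
        + 2 * real (M n) ^ 2 * exp (- 2 * (sqrt (real n * ln (real n)))\<^sup>2 / real n) \<le> 1 / 2 \<and>
      \<beta>\<^sup>2 / 24 * (real n powr (3/2) / ln (real n) powr (5/2)) \<le> real (M n) ^ 2 / (2 * (2 * sqrt (real n * ln (real n)) + 1))"
      using e1 e2 e3 e4
    proof eventually_elim
      case (elim n)
      define L where "L = ln (real n)"
      define N where "N = real n"
      note elim = elim[folded L_def N_def]
      have L: "3 \<le> L" and N: "4 \<le> N" "0 < L" using elim by auto
      have expL: "exp L = N" using N by (simp add: L_def N_def)
      define m where "m = \<beta> * N / L"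
      have m: "2 \<le> m" using elim(1) \<beta>(1) by (simp add: m_def field_simps)
      have Mle: "real (M n) \<le> m" and Mge: "m / 2 \<le> real (M n)" and Mpos: "0 < M n"
      proof -
        have "real (M n) = of_int \<lfloor>m\<rfloor>" using m by (simp add: M_def m_def N_def L_def)
        then show "real (M n) \<le> m" "m / 2 \<le> real (M n)" using m by linarith+
        then show "0 < M n" using m by linarith
      qed
      have "m \<le> N / L" using \<beta> N by (simp add: m_def divide_right_mono mult_left_le_one_le)
      then have MleNL: "real (M n) \<le> N / L" using Mle by linarith
      have "N / L \<le> N" using L N by (simp add: field_simps)
      then have MleN: "real (M n) \<le> N" using MleNL by linarith
      have term1: "real (M n) ^ 4 * exp (- c1 * N / real (M n)) \<le> 1 / 4"
      proof -
        have "5 * L * real (M n) \<le> 5 * L * m" using Mle N by (intro mult_left_mono) auto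
        also have "\<dots> = 5 * \<beta> * N" using N by (simp add: m_def)
        also have "\<dots> \<le> c1 * N" using \<beta>(3) N by (intro mult_right_mono) auto
        finally have "- c1 * N / real (M n) \<le> - (5 * L)" using Mpos by (simp add: field_simps)
        then have "exp (- c1 * N / real (M n)) \<le> exp (- (5 * L))" by simp
        also have "\<dots> = 1 / N ^ 5" using exp_of_nat_mult[of 5 L] by (simp add: exp_minus expL field_simps)
        finally have "real (M n) ^ 4 * exp (- c1 * N / real (M n)) \<le> N ^ 4 * (1 / N ^ 5)"
          using MleN N by (intro mult_mono power_mono) auto
        also have "\<dots> = 1 / N" using N by (simp add: field_simps eval_nat_numeral)
        also have "\<dots> \<le> 1 / 4" using N by (intro divide_left_mono) auto
        finally show ?thesis .
      qed
      have NL: "0 \<le> N * L" using N by simp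
      have term2: "2 * real (M n) ^ 2 * exp (- 2 * (sqrt (N * L))\<^sup>2 / N) \<le> 1 / 4"
      proof -
        have "exp (- 2 * (sqrt (N * L))\<^sup>2 / N) = exp (- (2 * L))" using N NL by simp
        also have "\<dots> = 1 / N\<^sup>2" using exp_of_nat_mult[of 2 L] by (simp add: exp_minus expL field_simps)
        finally have "2 * real (M n) ^ 2 * exp (- 2 * (sqrt (N * L))\<^sup>2 / N) = 2 * real (M n) ^ 2 * (1 / N\<^sup>2)" by simp
        also have "\<dots> \<le> 2 * (N / L) ^ 2 * (1 / N\<^sup>2)"
          using MleNL by (intro mult_mono power_mono) auto
        also have "\<dots> = 2 / L\<^sup>2" using N by (simp add: field_simps power2_eq_square)
        also have "\<dots> \<le> 2 / 3\<^sup>2" using L by (intro divide_left_mono power_mono) auto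
        finally show ?thesis by simp
      qed
      define s where "s = sqrt (N * L)"
      have s: "1 \<le> s" using elim(2) by (simp add: s_def)
      have "N powr (3/2) / L powr (5/2) = N\<^sup>2 / L\<^sup>2 / s"
      proof -
        have "N powr (3/2) = N powr 2 / N powr (1/2)" using powr_diff[of N 2 "1/2"] N by simp
        moreover have "L powr (5/2) = L powr 2 * L powr (1/2)" using powr_add[of L 2 "1/2"] by simp
        ultimately show ?thesis using N by (simp add: s_def powr_half_sqrt real_sqrt_mult powr_numeral)
      qed
      then have "\<beta>\<^sup>2 / 24 * (N powr (3/2) / L powr (5/2)) = (m / 2)\<^sup>2 / (2 * (3 * s))"
        by (simp add: m_def power_divide power_mult_distrib)
      also have "\<dots> \<le> real (M n) ^ 2 / (2 * (2 * s + 1))"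
        using Mge m s by (intro frac_le power_mono) auto
      finally show ?case
        using term1 term2 Mpos N NL unfolding s_def N_def L_def by auto
    qed
  qed
qed

theorem theorem4p19:
  fixes K C A :: "(real^2) set" and p :: real
  assumes "convex_body K" and "C = interior K"
    and "compact A" and "(\<lambda>y. 2 *\<^sub>R y) ` C \<subseteq> A"
    and "p = area C / area A"
  shows "\<exists>k :: nat \<Rightarrow> nat.
      (\<forall>n. expected A n (num_k_sets C (k n)) \<ge> expected A n (num_k_sets_within A C (k n))) \<and>
      (\<lambda>n. expected A n (num_k_sets_within A C (k n)))
        \<in> \<Omega>(\<lambda>n. real n powr (3/2) / ln (real n) powr (5/2)) \<and>
      (\<lambda>n. real (k n) - p * real n) \<in> O(\<lambda>n. sqrt (real n * ln (real n)))"
proof -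
  have K: "compact K" "convex K" "C \<noteq> {}" using assms(1,2) by (auto simp: convex_body_def)
  have C: "open C" "convex C" "bounded C"
    using K assms(2) by (auto intro: convex_interior bounded_interior compact_imp_bounded)
  have area_pos: "0 < area S" if "open S" "S \<noteq> {}" "S \<subseteq> B" "compact B" for S B :: "(real^2) set"
  proof -
    have "emeasure lborel S \<le> emeasure lborel B" using that by (intro emeasure_mono) (auto intro: borel_compact)
    then have "emeasure lborel S < \<infinity>" using emeasure_compact_finite[OF that(4)] by (auto intro: le_less_trans)
    moreover have "emeasure lborel S \<noteq> 0" using that open_not_negligible[of S]
      by (auto simp: negligible_iff_null_sets null_sets_completion_iff null_sets_def)
    ultimately show ?thesis by (simp add: measure_def enn2real_positive_iff zero_less_iff_neq_zero)
  qed
  have areaC: "0 < area C"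
    using C K assms(2) interior_subset by (intro area_pos[of C K]) auto
  have "0 < area ((\<lambda>y. 2 *\<^sub>R y) ` C)"
    using C K assms by (intro area_pos[of _ A] open_scaling) auto
  also have "\<dots> \<le> area A"
    using assms(3,4) emeasure_compact_finite[of A] C
    by (intro measure_mono_fmeasurable) (auto simp: fmeasurable_def borel_compact intro!: borel_open open_scaling)
  finally interpret uniform_points C A p
    using C areaC assms by unfold_locales auto
  obtain c1 where c1: "0 < c1"
    "\<And>M n \<epsilon>. 0 < M \<Longrightarrow> 0 < n \<Longrightarrow> 0 \<le> \<epsilon> \<Longrightarrow>
      real M ^ 4 * exp (- c1 * real n / real M) + 2 * real M ^ 2 * exp (- 2 * \<epsilon>\<^sup>2 / real n) \<le> 1 / 2 \<Longrightarrow>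
      \<exists>k. \<bar>real k - p * real n\<bar> < \<epsilon> \<and>
        real M ^ 2 / (2 * (2 * \<epsilon> + 1)) \<le> expected A n (num_k_sets_within A C k)"
    using exists_k_expected_ge[OF C(3) assms(4)] by blast
  obtain b and M :: "nat \<Rightarrow> nat" where b: "0 < b" and M:
    "\<forall>\<^sub>F n in sequentially. 0 < M n \<and> 0 < n \<and> 0 \<le> sqrt (real n * ln (real n)) \<and>
      real (M n) ^ 4 * exp (- c1 * real n / real (M n))
        + 2 * real (M n) ^ 2 * exp (- 2 * (sqrt (real n * ln (real n)))\<^sup>2 / real n) \<le> 1 / 2 \<and>
      b * (real n powr (3/2) / ln (real n) powr (5/2)) \<le> real (M n) ^ 2 / (2 * (2 * sqrt (real n * ln (real n)) + 1))"
    using grid_size_asymptotics[OF c1(1)] by blast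
  define good where "good n k \<longleftrightarrow> \<bar>real k - p * real n\<bar> < sqrt (real n * ln (real n)) \<and>
    b * (real n powr (3/2) / ln (real n) powr (5/2)) \<le> expected A n (num_k_sets_within A C k)" for n k
  \<comment> \<open>For the finitely many \<open>n\<close> without a good value the choice is arbitrary.\<close>
  define k where "k n = (SOME k. good n k)" for n
  have good: "\<forall>\<^sub>F n in sequentially. good n (k n)"
    using M
  proof eventually_elim
    case (elim n)
    then have "\<exists>k. good n k"
      using c1(2)[of "M n" n "sqrt (real n * ln (real n))"] unfolding good_def by (meson order_trans)
    then show "good n (k n)" unfolding k_def by (rule someI_ex)
  qed
  show ?thesis
  proof (intro exI[of _ k] conjI allI)
    show "expected A n (num_k_sets_within A C (k n)) \<le> expected A n (num_k_sets C (k n))" for n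
      by (rule expected_num_k_sets_ge)
    show "(\<lambda>n. expected A n (num_k_sets_within A C (k n))) \<in> \<Omega>(\<lambda>n. real n powr (3/2) / ln (real n) powr (5/2))"
    proof (rule landau_omega.bigI[OF b])
      show "\<forall>\<^sub>F n in sequentially. b * norm (real n powr (3/2) / ln (real n) powr (5/2))
          \<le> norm (expected A n (num_k_sets_within A C (k n)))"
        using good by eventually_elim (auto simp: good_def)
    qed
    show "(\<lambda>n. real (k n) - p * real n) \<in> O(\<lambda>n. sqrt (real n * ln (real n)))"
    proof (rule bigoI[of _ 1])
      show "\<forall>\<^sub>F n in sequentially. norm (real (k n) - p * real n) \<le> 1 * norm (sqrt (real n * ln (real n)))"
        using good
      proof eventually_elim
        case (elim n)
        then have "\<bar>real (k n) - p * real n\<bar> < sqrt (real n * ln (real n))" by (simp add: good_def)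
        then show ?case unfolding real_norm_def by linarith
      qed
    qed
  qed
qed

end
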